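(* Let $-\partial^2+u_s(x)$ be an algebro-geometric Schrödinger operator, with $u_s(x)$ an analytic potential in a complex open set $D$. Assume that the spectral curve $\Gamma_s$ of $L_s-\lambda$ is a rational curve. Then, for each $c$ in a domain $\Omega_c\subset D\times U\subset\mathbb{C}^2$, the equation $$(\partial-\tilde\phi_s(x,\tau))\Upsilon=0$$ has an analytic solution $\Upsilon(x,\tau)$ in a subdomain of $\Omega_c$.
   Context: Here $\partial=d/dx$, $L_s=-\partial^2+u_s$, and the nonconstant potential $u_s$ is regarded as an element of a differential field $(\Sigma,\partial)$ of functions of $x$ with field of constants $\mathbb{C}$. $L_s$ is algebro-geometric if some $P\in\Sigma[\partial]$ of odd order satisfies $[L_s,P]=0$. In that case there is a unique monic operator $A_{2s+1}$ of minimal order $2s+1$ (minimal among operators of the centralizer not in $\mathbb{C}[L_s]$) such that the centralizer of $L_s$ in $\Sigma[\partial]$ is $\mathbb{C}[L_s,A_{2s+1}]$ and $A_{2s+1}^2+R_{2s+1}(L_s)=0$ with $R_{2s+1}\in\mathbb{C}[\lambda]$ of degree $2s+1$. $K=\mathbb{C}\langle u_s\rangle$ is the differential field generated by $\mathbb{C}$ and $u_s$; $L_s,A_{2s+1}\in K[\partial]$. The spectral curve $\Gamma_s\subset\mathbb{C}^2$ is $\mu^2+R_{2s+1}(\lambda)=0$. When it is rational, there are a Zariski open set $U\subset\mathbb{C}$ and rational functions $\chi_1,\chi_2\in\mathbb{C}(\tau)$, regular on $U$, such that $\tau\mapsto(\chi_1(\tau),\chi_2(\tau))$ is an isomorphism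 of $U$ onto an open subset of $\Gamma_s$, inducing an isomorphism $\mathbb{C}(\Gamma_s)\simeq\mathbb{C}(\tau)$; one assumes that this open subset does not meet $Z_s=\{(\lambda,0):R_{2s+1}(\lambda)=0\}$. Let $K(\tau)$ have the derivation extending $\partial$ with $\partial\tau=0$. The monic greatest common right divisor of $L_s-\chi_1(\tau)$ and $A_{2s+1}-\chi_2(\tau)$ in $K(\tau)[\partial]$ has order one and is written $\partial-\tilde\phi_s$, with $\tilde\phi_s=\tilde\phi_s(x,\tau)\in K(\tau)$, a rational expression in $\tau$, $u_s(x)$ and the derivatives of $u_s(x)$. *)

theory Defs
  imports
    "HOL-Computational_Algebra.Computational_Algebra"
    "HOL-Computational_Algebra.Field_as_Ring"
    "HOL-Complex_Analysis.Complex_Analysis"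
begin

section \<open>Differential fields\<close>

definition derivation :: "('a::comm_ring_1 \<Rightarrow> 'a) \<Rightarrow> bool" where
  "derivation d \<longleftrightarrow>
     (\<forall>f g. d (f + g) = d f + d g) \<and> (\<forall>f g. d (f * g) = d f * g + f * d g)"

text \<open>The differential field is the type \<open>'k\<close> with derivation \<open>\<delta>\<close>; the map \<open>\<iota>\<close> identifies
  the complex numbers with its field of constants.\<close>

definition diff_field_const_C :: "('k::field \<Rightarrow> 'k) \<Rightarrow> (complex \<Rightarrow> 'k) \<Rightarrow> bool" where
  "diff_field_const_C \<delta> \<iota> \<longleftrightarrow>
     derivation \<delta> \<and>
     \<iota> 1 = 1 \<and> (\<forall>a b. \<iota> (a + b) = \<iota> a + \<iota> b) \<and> (\<forall>a b. \<iota> (a * b) = \<iota> a * \<iota> b) \<and>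
     {f. \<delta> f = 0} = range \<iota>"

inductive_set diff_field_gen :: "('k::field \<Rightarrow> 'k) \<Rightarrow> (complex \<Rightarrow> 'k) \<Rightarrow> 'k \<Rightarrow> 'k set"
  for \<delta> \<iota> u where
  const: "\<iota> c \<in> diff_field_gen \<delta> \<iota> u"
| gen: "u \<in> diff_field_gen \<delta> \<iota> u"
| add: "f \<in> diff_field_gen \<delta> \<iota> u \<Longrightarrow> g \<in> diff_field_gen \<delta> \<iota> u \<Longrightarrow> f + g \<in> diff_field_gen \<delta> \<iota> u"
| mult: "f \<in> diff_field_gen \<delta> \<iota> u \<Longrightarrow> g \<in> diff_field_gen \<delta> \<iota> u \<Longrightarrow> f * g \<in> diff_field_gen \<delta> \<iota> u"
| inverse: "f \<in> diff_field_gen \<delta> \<iota> u \<Longrightarrow> inverse f \<in> diff_field_gen \<delta> \<iota> u"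
| deriv: "f \<in> diff_field_gen \<delta> \<iota> u \<Longrightarrow> \<delta> f \<in> diff_field_gen \<delta> \<iota> u"

text \<open>The elements of the differential field \<open>K\<close> are functions of \<open>x \<in> D\<close>: \<open>ev f\<close> is the
  meromorphic function on \<open>D\<close> that \<open>f\<close> stands for. As usual for meromorphic functions, the
  identities hold off a set of isolated points. Since \<open>ev f\<close> is \<^emph>\<open>nicely\<close> meromorphic,
  removable singularities are removed, so that \<open>ev f\<close> is analytic at every point of \<open>D\<close>
  other than its poles.\<close>

definition field_of_functions ::
  "complex set \<Rightarrow> 'k set \<Rightarrow> ('k::field \<Rightarrow> 'k) \<Rightarrow> (complex \<Rightarrow> 'k) \<Rightarrow> ('k \<Rightarrow> complex \<Rightarrow> complex) \<Rightarrow> bool"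
where
  "field_of_functions D K \<delta> \<iota> ev \<longleftrightarrow>
     (\<forall>f\<in>K. ev f nicely_meromorphic_on D) \<and>
     (\<forall>c. \<forall>\<^sub>\<approx>x\<in>D. ev (\<iota> c) x = c) \<and>
     (\<forall>f\<in>K. \<forall>g\<in>K. \<forall>\<^sub>\<approx>x\<in>D. ev (f + g) x = ev f x + ev g x) \<and>
     (\<forall>f\<in>K. \<forall>g\<in>K. \<forall>\<^sub>\<approx>x\<in>D. ev (f * g) x = ev f x * ev g x) \<and>
     (\<forall>f\<in>K. \<forall>\<^sub>\<approx>x\<in>D. ev (\<delta> f) x = deriv (ev f) x)"


section \<open>Ordinary differential operators\<close>

text \<open>The operator \<open>\<Sum>i. a\<^sub>i \<partial>\<^sup>i\<close> is represented by the polynomial with coefficients \<open>a\<^sub>i\<close>; its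
  order is the degree. Addition is that of polynomials, but the product is the one determined
  by \<open>\<partial> a = a \<partial> + d a\<close>. The operator \<open>dop_D d Q\<close> is \<open>\<partial> Q\<close>.\<close>

definition dop_D :: "('a::comm_ring_1 \<Rightarrow> 'a) \<Rightarrow> 'a poly \<Rightarrow> 'a poly" where
  "dop_D d Q = pCons 0 Q + map_poly d Q"

definition dop_mult :: "('a::comm_ring_1 \<Rightarrow> 'a) \<Rightarrow> 'a poly \<Rightarrow> 'a poly \<Rightarrow> 'a poly" where
  "dop_mult d P Q = (\<Sum>i\<le>degree P. smult (coeff P i) ((dop_D d ^^ i) Q))"

definition dop_commutator :: "('a::comm_ring_1 \<Rightarrow> 'a) \<Rightarrow> 'a poly \<Rightarrow> 'a poly \<Rightarrow> 'a poly" where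
  "dop_commutator d P Q = dop_mult d P Q - dop_mult d Q P"

definition dop_centralizer :: "('a::comm_ring_1 \<Rightarrow> 'a) \<Rightarrow> 'a poly \<Rightarrow> 'a poly set" where
  "dop_centralizer d L = {P. dop_commutator d L P = 0}"

definition dop_eval ::
  "('k::field \<Rightarrow> 'k) \<Rightarrow> (complex \<Rightarrow> 'k) \<Rightarrow> complex poly \<Rightarrow> 'k poly \<Rightarrow> 'k poly" where
  "dop_eval \<delta> \<iota> R L = (\<Sum>i\<le>degree R. smult (\<iota> (coeff R i)) ((dop_mult \<delta> L ^^ i) 1))"

text \<open>The \<open>\<complex>\<close>-algebra of operators generated by \<open>S\<close>.\<close>

inductive_set dop_algebra :: "('k::field \<Rightarrow> 'k) \<Rightarrow> (complex \<Rightarrow> 'k) \<Rightarrow> 'k poly set \<Rightarrow> 'k poly set"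
  for \<delta> \<iota> S where
  const: "[:\<iota> c:] \<in> dop_algebra \<delta> \<iota> S"
| gen: "P \<in> S \<Longrightarrow> P \<in> dop_algebra \<delta> \<iota> S"
| add: "P \<in> dop_algebra \<delta> \<iota> S \<Longrightarrow> Q \<in> dop_algebra \<delta> \<iota> S \<Longrightarrow> P + Q \<in> dop_algebra \<delta> \<iota> S"
| mult: "P \<in> dop_algebra \<delta> \<iota> S \<Longrightarrow> Q \<in> dop_algebra \<delta> \<iota> S \<Longrightarrow> dop_mult \<delta> P Q \<in> dop_algebra \<delta> \<iota> S"

text \<open>Monic greatest common right divisor in \<open>M[\<partial>]\<close>, for a differential subfield \<open>M\<close>.\<close>

definition dops_over :: "'a::comm_ring_1 set \<Rightarrow> 'a poly set" where
  "dops_over M = {P. \<forall>i. coeff P i \<in> M}"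

definition dop_right_dvd :: "('a::comm_ring_1 \<Rightarrow> 'a) \<Rightarrow> 'a set \<Rightarrow> 'a poly \<Rightarrow> 'a poly \<Rightarrow> bool" where
  "dop_right_dvd d M G P \<longleftrightarrow> (\<exists>Q\<in>dops_over M. P = dop_mult d Q G)"

definition is_monic_gcrd ::
  "('a::comm_ring_1 \<Rightarrow> 'a) \<Rightarrow> 'a set \<Rightarrow> 'a poly \<Rightarrow> 'a poly \<Rightarrow> 'a poly \<Rightarrow> bool" where
  "is_monic_gcrd d M P Q G \<longleftrightarrow>
     G \<in> dops_over M \<and> lead_coeff G = 1 \<and>
     dop_right_dvd d M G P \<and> dop_right_dvd d M G Q \<and>
     (\<forall>H\<in>dops_over M. dop_right_dvd d M H P \<longrightarrow> dop_right_dvd d M H Q \<longrightarrow>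
        dop_right_dvd d M H G)"


section \<open>Algebro-geometric Schroedinger operators\<close>

definition schroedinger :: "'k::field \<Rightarrow> 'k poly" where
  "schroedinger u = [:u, 0, -1:]"

definition algebro_geometric :: "('k::field \<Rightarrow> 'k) \<Rightarrow> 'k poly \<Rightarrow> bool" where
  "algebro_geometric \<delta> L \<longleftrightarrow> (\<exists>P. odd (degree P) \<and> dop_commutator \<delta> L P = 0)"

definition centralizer_generator ::
  "('k::field \<Rightarrow> 'k) \<Rightarrow> (complex \<Rightarrow> 'k) \<Rightarrow> 'k poly \<Rightarrow> nat \<Rightarrow> 'k poly \<Rightarrow> complex poly \<Rightarrow> bool" where
  "centralizer_generator \<delta> \<iota> L s A R \<longleftrightarrow>
     A \<in> dop_centralizer \<delta> L - dop_algebra \<delta> \<iota> {L} \<and>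
     lead_coeff A = 1 \<and> degree A = 2 * s + 1 \<and>
     (\<forall>P \<in> dop_centralizer \<delta> L - dop_algebra \<delta> \<iota> {L}. degree A \<le> degree P) \<and>
     dop_centralizer \<delta> L = dop_algebra \<delta> \<iota> {L, A} \<and>
     degree R = 2 * s + 1 \<and>
     dop_mult \<delta> A A + dop_eval \<delta> \<iota> R L = 0"


section \<open>The spectral curve and its rational parametrizations\<close>

text \<open>Polynomials in two variables are elements of \<open>\<complex>[\<lambda>][\<mu>]\<close>; \<open>eval2 h F a b\<close> is \<open>F(a,b)\<close> in a
  ring to which \<open>h\<close> maps the coefficients.\<close>

definition eval2 :: "(complex \<Rightarrow> 'a::comm_ring_1) \<Rightarrow> complex poly poly \<Rightarrow> 'a \<Rightarrow> 'a \<Rightarrow> 'a" where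
  "eval2 h F a b = poly (map_poly (\<lambda>p. poly (map_poly h p) a) F) b"

definition spectral_poly :: "complex poly \<Rightarrow> complex poly poly" where
  "spectral_poly R = [:R, 0, 1:]"

definition spectral_curve :: "complex poly \<Rightarrow> (complex \<times> complex) set" where
  "spectral_curve R = {(a, b). b ^ 2 + poly R a = 0}"

definition branch_points :: "complex poly \<Rightarrow> (complex \<times> complex) set" where
  "branch_points R = {(a, b). b = 0 \<and> poly R a = 0}"

text \<open>The field \<open>\<complex>(\<tau>)\<close> is \<^typ>\<open>complex poly fract\<close>. The homomorphism
  \<open>\<complex>[\<lambda>,\<mu>]/(\<mu>\<^sup>2 + R(\<lambda>)) \<rightarrow> \<complex>(\<tau>)\<close>, \<open>\<lambda> \<mapsto> \<chi>\<^sub>1\<close>, \<open>\<mu> \<mapsto> \<chi>\<^sub>2\<close>, is well defined and injective (first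
  condition), and its extension to the field of fractions \<open>\<complex>(\<Gamma>)\<close> is onto (second condition).\<close>

definition function_field_iso ::
  "complex poly \<Rightarrow> complex poly fract \<Rightarrow> complex poly fract \<Rightarrow> bool" where
  "function_field_iso R \<chi>1 \<chi>2 \<longleftrightarrow>
     (\<forall>F. eval2 (\<lambda>c. Fract [:c:] 1) F \<chi>1 \<chi>2 = 0 \<longleftrightarrow> spectral_poly R dvd F) \<and>
     (\<forall>r. \<exists>F G. eval2 (\<lambda>c. Fract [:c:] 1) G \<chi>1 \<chi>2 \<noteq> 0 \<and>
        r = eval2 (\<lambda>c. Fract [:c:] 1) F \<chi>1 \<chi>2 / eval2 (\<lambda>c. Fract [:c:] 1) G \<chi>1 \<chi>2)"

definition rational_spectral_curve :: "complex poly \<Rightarrow> bool" where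
  "rational_spectral_curve R \<longleftrightarrow> (\<exists>\<chi>1 \<chi>2. function_field_iso R \<chi>1 \<chi>2)"

definition ratfun_regular :: "complex poly fract \<Rightarrow> complex \<Rightarrow> bool" where
  "ratfun_regular r t \<longleftrightarrow> poly (snd (quot_of_fract r)) t \<noteq> 0"

definition ratfun_val :: "complex poly fract \<Rightarrow> complex \<Rightarrow> complex" where
  "ratfun_val r t = poly (fst (quot_of_fract r)) t / poly (snd (quot_of_fract r)) t"

definition zariski_open :: "complex set \<Rightarrow> bool" where
  "zariski_open U \<longleftrightarrow> (\<exists>S. U = {t. \<exists>p\<in>S. poly p t \<noteq> 0})"

definition zariski_open_in :: "(complex \<times> complex) set \<Rightarrow> (complex \<times> complex) set \<Rightarrow> bool" where
  "zariski_open_in \<Gamma> V \<longleftrightarrow> (\<exists>S. V = {(a, b) \<in> \<Gamma>. \<exists>F\<in>S. eval2 id F a b \<noteq> 0})"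

definition regular_function :: "(complex \<times> complex) set \<Rightarrow> (complex \<times> complex \<Rightarrow> complex) \<Rightarrow> bool" where
  "regular_function V f \<longleftrightarrow>
     (\<forall>(a0, b0) \<in> V. \<exists>F G. eval2 id G a0 b0 \<noteq> 0 \<and>
        (\<forall>(a, b) \<in> V. eval2 id G a b \<noteq> 0 \<longrightarrow> f (a, b) = eval2 id F a b / eval2 id G a b))"

definition curve_param ::
  "complex poly fract \<Rightarrow> complex poly fract \<Rightarrow> complex \<Rightarrow> complex \<times> complex" where
  "curve_param \<chi>1 \<chi>2 t = (ratfun_val \<chi>1 t, ratfun_val \<chi>2 t)"

definition rational_parametrization ::
  "complex poly \<Rightarrow> complex set \<Rightarrow> complex poly fract \<Rightarrow> complex poly fract \<Rightarrow> bool" where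
  "rational_parametrization R U \<chi>1 \<chi>2 \<longleftrightarrow>
     zariski_open U \<and> U \<noteq> {} \<and>
     (\<forall>t\<in>U. ratfun_regular \<chi>1 t \<and> ratfun_regular \<chi>2 t) \<and>
     zariski_open_in (spectral_curve R) (curve_param \<chi>1 \<chi>2 ` U) \<and>
     inj_on (curve_param \<chi>1 \<chi>2) U \<and>
     regular_function (curve_param \<chi>1 \<chi>2 ` U) (inv_into U (curve_param \<chi>1 \<chi>2)) \<and>
     function_field_iso R \<chi>1 \<chi>2 \<and>
     curve_param \<chi>1 \<chi>2 ` U \<inter> branch_points R = {}"


section \<open>The field \<open>K(\<tau>)\<close>\<close>

text \<open>Rational functions of \<open>\<tau>\<close> over the whole differential field are \<^typ>\<open>'k poly fract\<close>;
  \<open>ratfuns_over K\<close> is the subfield \<open>K(\<tau>)\<close>.\<close>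

definition ratfuns_over :: "'k::field set \<Rightarrow> 'k poly fract set" where
  "ratfuns_over K =
     {Fract p q | p q. q \<noteq> 0 \<and> (\<forall>i. coeff p i \<in> K) \<and> (\<forall>i. coeff q i \<in> K)}"

definition tau_const :: "'k::field \<Rightarrow> 'k poly fract" where
  "tau_const f = Fract [:f:] 1"

definition tau :: "'k::field poly fract" where
  "tau = Fract [:0, 1:] 1"

text \<open>These conditions determine \<open>d\<close> uniquely.\<close>

definition extends_to_tau :: "('k::field \<Rightarrow> 'k) \<Rightarrow> ('k poly fract \<Rightarrow> 'k poly fract) \<Rightarrow> bool" where
  "extends_to_tau \<delta> d \<longleftrightarrow> derivation d \<and> (\<forall>f. d (tau_const f) = tau_const (\<delta> f)) \<and> d tau = 0"

text \<open>The inclusion of \<open>\<complex>(\<tau>)\<close>.\<close>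

definition ratfun_embed :: "(complex \<Rightarrow> 'k::field) \<Rightarrow> complex poly fract \<Rightarrow> 'k poly fract" where
  "ratfun_embed \<iota> r =
     Fract (map_poly \<iota> (fst (quot_of_fract r))) (map_poly \<iota> (snd (quot_of_fract r)))"

text \<open>\<open>\<partial> - \<phi>\<close> is the monic greatest common right divisor of \<open>L - \<chi>\<^sub>1(\<tau>)\<close> and \<open>A - \<chi>\<^sub>2(\<tau>)\<close>
  in \<open>K(\<tau>)[\<partial>]\<close>.\<close>

definition spectral_right_factor ::
  "('k::field poly fract \<Rightarrow> 'k poly fract) \<Rightarrow> (complex \<Rightarrow> 'k) \<Rightarrow> 'k set \<Rightarrow> 'k poly \<Rightarrow> 'k poly \<Rightarrow>
   complex poly fract \<Rightarrow> complex poly fract \<Rightarrow> 'k poly fract \<Rightarrow> bool" where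
  "spectral_right_factor d \<iota> K L A \<chi>1 \<chi>2 \<phi> \<longleftrightarrow>
     is_monic_gcrd d (ratfuns_over K)
       (map_poly tau_const L - [:ratfun_embed \<iota> \<chi>1:])
       (map_poly tau_const A - [:ratfun_embed \<iota> \<chi>2:])
       [:- \<phi>, 1:]"

text \<open>\<open>\<phi> \<in> K(\<tau>)\<close> as a function of \<open>(x, \<tau>)\<close>: it is defined at \<open>(x, t)\<close>, with value \<open>v\<close>, if it is a
  quotient of polynomials in \<open>\<tau>\<close> whose coefficients are analytic at \<open>x\<close> and whose denominator
  does not vanish at \<open>(x, t)\<close>.\<close>

definition has_value_at ::
  "'k::field set \<Rightarrow> ('k \<Rightarrow> complex \<Rightarrow> complex) \<Rightarrow> 'k poly fract \<Rightarrow> complex \<times> complex \<Rightarrow> complex \<Rightarrow> bool"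
where
  "has_value_at K ev \<phi> = (\<lambda>(x, t) v. \<exists>p q. \<phi> = Fract p q \<and> q \<noteq> 0 \<and>
     (\<forall>i. coeff p i \<in> K \<and> ev (coeff p i) analytic_on {x}) \<and>
     (\<forall>i. coeff q i \<in> K \<and> ev (coeff q i) analytic_on {x}) \<and>
     (\<Sum>i\<le>degree q. ev (coeff q i) x * t ^ i) \<noteq> 0 \<and>
     v = (\<Sum>i\<le>degree p. ev (coeff p i) x * t ^ i) / (\<Sum>i\<le>degree q. ev (coeff q i) x * t ^ i))"

definition regular_at ::
  "'k::field set \<Rightarrow> ('k \<Rightarrow> complex \<Rightarrow> complex) \<Rightarrow> 'k poly fract \<Rightarrow> complex \<times> complex \<Rightarrow> bool" where
  "regular_at K ev \<phi> z \<longleftrightarrow> (\<exists>v. has_value_at K ev \<phi> z v)"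

definition value_at ::
  "'k::field set \<Rightarrow> ('k \<Rightarrow> complex \<Rightarrow> complex) \<Rightarrow> 'k poly fract \<Rightarrow> complex \<times> complex \<Rightarrow> complex" where
  "value_at K ev \<phi> z = (THE v. has_value_at K ev \<phi> z v)"


section \<open>Analytic functions of two complex variables\<close>

text \<open>Complex differentiability in a neighbourhood of each point, as for \<open>analytic_on\<close>
  in one variable.\<close>

definition holomorphic2_on :: "(complex \<times> complex \<Rightarrow> complex) \<Rightarrow> (complex \<times> complex) set \<Rightarrow> bool" where
  "holomorphic2_on f W \<longleftrightarrow>
     (\<forall>z\<in>W. \<exists>a b. (f has_derivative (\<lambda>(h, k). a * h + b * k)) (at z within W))"

definition analytic2_on :: "(complex \<times> complex \<Rightarrow> complex) \<Rightarrow> (complex \<times> complex) set \<Rightarrow> bool" where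
  "analytic2_on f W \<longleftrightarrow> (\<forall>z\<in>W. \<exists>e>0. holomorphic2_on f (ball z e))"

definition is_domain :: "(complex \<times> complex) set \<Rightarrow> bool" where
  "is_domain W \<longleftrightarrow> open W \<and> connected W \<and> W \<noteq> {}"

end

theory Submission
  imports Defs
begin

text \<open>Near a point where it is regular, \<open>\<phi>\<close> is a quotient \<open>P(x,\<tau>) / Q(x,\<tau>)\<close> of polynomials in
  \<open>\<tau>\<close> whose coefficients are analytic in \<open>x\<close>, with \<open>Q \<noteq> 0\<close>. So \<open>\<phi>\<close> is jointly analytic there,
  and on a product of two discs around \<open>(x\<^sub>0, t\<^sub>0)\<close> the linear equation is solved by
  \<open>\<Upsilon>(x,\<tau>) = exp (\<integral>\<^bsub>x\<^sub>0\<^esub>\<^bsup>x\<^esup> \<phi>(\<xi>,\<tau>) d\<xi>)\<close>, which has no zeros. What has to be proved is that the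
  integral is analytic in both variables (\<open>holomorphic2_parameter_primitive\<close>): integrating along
  segments gives the \<open>x\<close>-derivative by Cauchy's theorem and the \<open>\<tau>\<close>-derivative by differentiation
  under the integral sign.

  Two points concern the passage from the field \<open>K(\<tau>)\<close> to functions. The value of \<open>\<phi>\<close> at a point
  must be the same for all representations \<open>P/Q\<close> (\<open>has_value_at_unique\<close>): two of
  them satisfy \<open>P Q' = P' Q\<close> off a discrete set of \<open>x\<close>, hence wherever the coefficients are
  analytic, by continuity. And there
  must be regular points at all (\<open>exists_has_value_at\<close>): the leading coefficient of \<open>Q\<close> is
  invertible in \<open>K\<close>, so it has nonzero values off a discrete set, and for such an \<open>x\<close> only
  finitely many \<open>\<tau>\<close> are zeros of \<open>Q\<close>, while \<open>U\<close> is cofinite.\<close>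

section \<open>Primitives depending on a parameter\<close>

text \<open>A function with partial derivatives in both variables, one of them jointly continuous, is
  jointly differentiable. For the integral of \<open>g\<close> along segments from \<open>w\<close> the \<open>x\<close>-derivative is
  \<open>g\<close> itself, whose joint continuity is assumed; it remains to produce the \<open>t\<close>-derivative,
  by the Leibniz rule.\<close>

lemma holomorphic2_parameter_primitive:
  fixes g gt :: "complex \<Rightarrow> complex \<Rightarrow> complex"
  assumes X: "open X" "convex X" "w \<in> X" and T: "open T" "convex T"
    and hol: "\<And>t. t \<in> T \<Longrightarrow> (\<lambda>x. g x t) holomorphic_on X"
    and der: "\<And>x t. x \<in> X \<Longrightarrow> t \<in> T \<Longrightarrow> (g x has_field_derivative gt x t) (at t)"
    and cont: "continuous_on (X \<times> T) (\<lambda>(x, t). g x t)" "continuous_on (X \<times> T) (\<lambda>(x, t). gt x t)"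
  obtains F where "\<And>x t. x \<in> X \<Longrightarrow> t \<in> T \<Longrightarrow> ((\<lambda>x. F (x, t)) has_field_derivative g x t) (at x)"
    and "holomorphic2_on F (X \<times> T)"
proof -
  define I where "I t x = contour_integral (linepath w x) (\<lambda>\<xi>. g \<xi> t)" for t x
  have seg: "linepath w x r \<in> X" if "x \<in> X" "r \<in> {0..1}" for x r
    using closed_segment_subset[OF X(3) that(1) X(2)] linepath_in_path[OF that(2), of w x] by blast
  have Ix: "(I t has_field_derivative g x t) (at x)" if "x \<in> X" "t \<in> T" for x t
  proof -
    obtain G where G: "\<And>y. y \<in> X \<Longrightarrow> (G has_field_derivative g y t) (at y within X)"
      using holomorphic_convex_primitive'[OF X(2,1) hol[OF \<open>t \<in> T\<close>]] by blast
    \<comment> \<open>\<open>G\<close> is chosen separately for each \<open>t\<close> and need not vary well with it; the segment integral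
      is the primitive normalized to vanish at \<open>w\<close>.\<close>
    have eq: "I t y = G y - G w" if "y \<in> X" for y
    proof -
      have "closed_segment w y \<subseteq> X" using that X by (simp add: closed_segment_subset)
      then have "((\<lambda>\<xi>. g \<xi> t) has_contour_integral
          G (pathfinish (linepath w y)) - G (pathstart (linepath w y))) (linepath w y)"
        using contour_integral_primitive[where S = X and f = G and f' = "\<lambda>\<xi>. g \<xi> t"
          and g = "linepath w y", OF G] by simp
      then show ?thesis by (simp add: I_def contour_integral_unique)
    qed
    have "((\<lambda>y. G y - G w) has_field_derivative g x t) (at x)"
      using G[OF \<open>x \<in> X\<close>] at_within_open[OF \<open>x \<in> X\<close> X(1)] by (auto intro!: derivative_eq_intros)
    then show ?thesis
      by (rule has_field_derivative_transform_within_open[OF _ X(1) \<open>x \<in> X\<close>]) (simp add: eq)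
  qed
  have It: "\<exists>c. ((\<lambda>t. I t x) has_field_derivative c) (at t)" if "x \<in> X" "t \<in> T" for x t
  proof -
    have It_eq: "(\<lambda>t. I t x) = (\<lambda>t. integral (cbox 0 1) (\<lambda>r. g (linepath w x r) t * (x - w)))"
      by (simp add: I_def contour_integral_integral)
    have line: "continuous_on S (linepath w x)" for S
      unfolding linepath_def[abs_def] by (intro continuous_intros)
    have cont_g: "continuous_on (cbox 0 1) (\<lambda>r. g (linepath w x r) s)" if "s \<in> T" for s
    proof -
      have "continuous_on (cbox 0 1) (\<lambda>r. (linepath w x r, s))"
        by (intro continuous_on_Pair line continuous_on_const)
      from continuous_on_compose2[OF cont(1) this] show ?thesis
        using seg[OF \<open>x \<in> X\<close>] that by (auto simp: image_subset_iff)
    qed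
    have cont_gt: "continuous_on (T \<times> cbox 0 1) (\<lambda>z. gt (linepath w x (snd z)) (fst z))"
    proof -
      have "continuous_on (T \<times> cbox 0 1) (\<lambda>z. (linepath w x (snd z), fst z))"
        by (intro continuous_on_Pair continuous_on_compose2[OF line[of UNIV]] continuous_on_snd
            continuous_on_fst continuous_on_id) auto
      from continuous_on_compose2[OF cont(2) this] show ?thesis
        using seg[OF \<open>x \<in> X\<close>] by (auto simp: image_subset_iff)
    qed
    have "((\<lambda>t. integral (cbox 0 1) (\<lambda>r. g (linepath w x r) t * (x - w))) has_field_derivative
        integral (cbox 0 1) (\<lambda>r. gt (linepath w x r) t * (x - w))) (at t within T)"
    proof (rule leibniz_rule_field_derivative)
      show "((\<lambda>s. g (linepath w x r) s * (x - w)) has_field_derivative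
          gt (linepath w x r) s * (x - w)) (at s within T)" if "s \<in> T" "r \<in> cbox 0 1" for s r
        using der[of "linepath w x r" s] seg[of x r] that \<open>x \<in> X\<close>
        by (auto intro!: DERIV_cmult_right intro: has_field_derivative_at_within)
      show "(\<lambda>r. g (linepath w x r) s * (x - w)) integrable_on cbox 0 1" if "s \<in> T" for s
        by (intro integrable_continuous continuous_on_mult_right cont_g that)
      show "continuous_on (T \<times> cbox 0 1) (\<lambda>(s, r). gt (linepath w x r) s * (x - w))"
        unfolding split_beta by (intro continuous_on_mult_right cont_gt)
    qed (use that T in auto)
    then show ?thesis
      unfolding It_eq at_within_open[OF \<open>t \<in> T\<close> T(1)] by blast
  qed
  show ?thesis
  proof (rule that[of "\<lambda>(x, t). I t x"])
    show "((\<lambda>x. case (x, t) of (x, t) \<Rightarrow> I t x) has_field_derivative g x t) (at x)"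
      if "x \<in> X" "t \<in> T" for x t
      using Ix[OF that] by simp
    show "holomorphic2_on (\<lambda>(x, t). I t x) (X \<times> T)"
      unfolding holomorphic2_on_def
    proof (clarify)
      fix x t assume xt: "x \<in> X" "t \<in> T"
      obtain c where c: "((\<lambda>t. I t x) has_field_derivative c) (at t)" using It[OF xt] by blast
      \<comment> \<open>The partial derivative known to be continuous must belong to the second component, hence
        the order \<open>(t, x)\<close> here and the swap below.\<close>
      have "((\<lambda>(t, x). I t x) has_derivative (\<lambda>(k, h). c * k + blinfun_mult_right (g x t) h))
          (at (t, x) within T \<times> X)"
      proof (rule has_derivative_partialsI)
        show "((\<lambda>t. I t x) has_derivative (\<lambda>k. c * k)) (at t within T)"
          using c by (simp add: has_field_derivative_def has_derivative_at_withinI)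
        show "(I s has_derivative blinfun_apply (blinfun_mult_right (g y s))) (at y within X)"
          if "s \<in> T" "y \<in> X" for s y
          using Ix[OF that(2,1)]
          by (simp add: has_field_derivative_def has_derivative_at_withinI)
        have "continuous_on (T \<times> X) (\<lambda>z. g (snd z) (fst z))"
          using continuous_on_compose2[OF cont(1) continuous_on_swap[of "T \<times> X"]]
          by (force simp: split_beta)
        then have "continuous_on (T \<times> X) (\<lambda>z. blinfun_mult_right (g (snd z) (fst z)))"
          by (intro bounded_linear.continuous_on[OF bounded_linear_blinfun_mult_right])
        then show "continuous (at (t, x) within T \<times> X) (\<lambda>(t, x). blinfun_mult_right (g x t))"
          using xt unfolding continuous_on_eq_continuous_within split_beta by auto
      qed (use xt X in auto)
      moreover have "at (t, x) within T \<times> X = at (t, x)"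
        using xt X T by (intro at_within_open) (auto simp: open_Times)
      ultimately have D: "((\<lambda>(t, x). I t x) has_derivative (\<lambda>(k, h). c * k + g x t * h))
          (at (prod.swap (x, t)))"
        by simp
      have "(prod.swap has_derivative prod.swap) (at (x, t) within X \<times> T)"
        unfolding prod.swap_def by (auto intro!: derivative_eq_intros)
      from has_derivative_compose[OF this D]
      have "((\<lambda>(x, t). I t x) has_derivative (\<lambda>(h, k). c * k + g x t * h)) (at (x, t) within X \<times> T)"
        by (simp add: split_beta')
      moreover have "(\<lambda>(h, k). c * k + g x t * h) = (\<lambda>(h, k). g x t * h + c * k)"
        by (auto simp: add.commute)
      ultimately show "\<exists>a b. ((\<lambda>(x, t). I t x) has_derivative (\<lambda>(h, k). a * h + b * k))
          (at (x, t) within X \<times> T)"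
        by auto
    qed
  qed
qed

lemma analytic2_on_exp:
  assumes "holomorphic2_on F W" "open W"
  shows "analytic2_on (\<lambda>z. exp (F z)) W"
  unfolding analytic2_on_def
proof
  fix z assume "z \<in> W"
  then obtain e where e: "e > 0" "ball z e \<subseteq> W" using assms(2) openE by blast
  have "\<exists>a b. ((\<lambda>z. exp (F z)) has_derivative (\<lambda>(h, k). a * h + b * k)) (at y within ball z e)"
    if "y \<in> ball z e" for y
  proof -
    obtain a b where "(F has_derivative (\<lambda>(h, k). a * h + b * k)) (at y within W)"
      using assms(1) e(2) \<open>y \<in> ball z e\<close> unfolding holomorphic2_on_def by blast
    then have "(F has_derivative (\<lambda>(h, k). a * h + b * k)) (at y within ball z e)"
      using e(2) by (rule has_derivative_subset)
    moreover have "(exp has_derivative (*) (exp (F y))) (at (F y))"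
      using DERIV_exp[of "F y"] by (simp add: has_field_derivative_def)
    ultimately have "((\<lambda>z. exp (F z)) has_derivative (\<lambda>w. exp (F y) * (case w of (h, k) \<Rightarrow> a * h + b * k)))
        (at y within ball z e)"
      by (rule has_derivative_compose)
    moreover have "(\<lambda>w. exp (F y) * (case w of (h, k) \<Rightarrow> a * h + b * k)) =
        (\<lambda>(h, k). (exp (F y) * a) * h + (exp (F y) * b) * k)"
      by (auto simp: algebra_simps)
    ultimately show ?thesis by auto
  qed
  then show "\<exists>e>0. holomorphic2_on (\<lambda>z. exp (F z)) (ball z e)"
    using e(1) unfolding holomorphic2_on_def by blast
qed

section \<open>Rational functions of the parameter with analytic coefficients\<close>

definition tau_eval :: "('k::zero \<Rightarrow> complex \<Rightarrow> complex) \<Rightarrow> 'k poly \<Rightarrow> complex \<Rightarrow> complex \<Rightarrow> complex" where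
  "tau_eval ev p x t = (\<Sum>i\<le>degree p. ev (coeff p i) x * t ^ i)"

lemma has_value_at_iff:
  "has_value_at K ev \<phi> (x, t) v \<longleftrightarrow> (\<exists>p q. \<phi> = Fract p q \<and> q \<noteq> 0 \<and>
     (\<forall>i. coeff p i \<in> K \<and> ev (coeff p i) analytic_on {x}) \<and>
     (\<forall>i. coeff q i \<in> K \<and> ev (coeff q i) analytic_on {x}) \<and>
     tau_eval ev q x t \<noteq> 0 \<and> v = tau_eval ev p x t / tau_eval ev q x t)"
  by (simp add: has_value_at_def tau_eval_def)

lemma holomorphic_on_tau_eval:
  assumes "\<And>i. ev (coeff p i) holomorphic_on X"
  shows "(\<lambda>x. tau_eval ev p x t) holomorphic_on X"
  unfolding tau_eval_def by (intro holomorphic_intros assms)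

lemma continuous_on_tau_eval:
  assumes "\<And>i. ev (coeff p i) holomorphic_on X"
  shows "continuous_on (X \<times> T) (\<lambda>(x, t). tau_eval ev p x t)"
  unfolding tau_eval_def split_beta
  by (intro continuous_intros continuous_on_compose2[OF holomorphic_on_imp_continuous_on[OF assms]]) auto

lemma tau_eval_derivative_tau:
  assumes "\<And>i. ev (coeff p i) holomorphic_on X"
  obtains p' where "\<And>x t. (tau_eval ev p x has_field_derivative p' x t) (at t)"
    and "continuous_on (X \<times> T) (\<lambda>(x, t). p' x t)"
proof
  show "(tau_eval ev p x has_field_derivative (\<Sum>i\<le>degree p. ev (coeff p i) x * (of_nat i * t ^ (i - 1)))) (at t)"
    for x t
    unfolding tau_eval_def[abs_def] by (auto intro!: derivative_eq_intros sum.cong)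
  show "continuous_on (X \<times> T) (\<lambda>(x, t). \<Sum>i\<le>degree p. ev (coeff p i) x * (of_nat i * t ^ (i - 1)))"
    unfolding split_beta
    by (intro continuous_intros continuous_on_compose2[OF holomorphic_on_imp_continuous_on[OF assms]]) auto
qed

lemma finite_analytic_imp_holomorphic_ball:
  assumes "finite S" "\<And>f. f \<in> S \<Longrightarrow> f analytic_on {x::complex}"
  obtains r where "r > 0" "\<And>f. f \<in> S \<Longrightarrow> f holomorphic_on ball x r"
proof -
  have "\<forall>f\<in>S. \<exists>r>0. f holomorphic_on ball x r"
    using assms(2) by (auto simp: analytic_on_def)
  then obtain \<rho> where \<rho>: "\<And>f. f \<in> S \<Longrightarrow> \<rho> f > 0 \<and> f holomorphic_on ball x (\<rho> f)" by metis
  show ?thesis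
  proof (rule that[of "Min (insert 1 (\<rho> ` S))"])
    show "f holomorphic_on ball x (Min (insert 1 (\<rho> ` S)))" if "f \<in> S" for f
      using \<rho>[OF that] assms(1) that
      by (elim conjE, rule_tac holomorphic_on_subset) (auto intro!: subset_ball)
  qed (use assms(1) \<rho> in auto)
qed

lemma range_coeff: "range (coeff p) = insert 0 (coeff p ` {..degree p})"
  by (auto simp: image_iff) (metis atMost_iff coeff_eq_0 not_le, metis coeff_eq_0 lessI)

text \<open>Regularity at a point is an open condition, and a single representation \<open>p/q\<close> serves a whole
  neighbourhood: \<open>p\<close> and \<open>q\<close> have finitely many coefficients, which are analytic on a common disc,
  and \<open>q\<close> stays nonzero by continuity.\<close>

lemma has_value_at_box:
  assumes "has_value_at K ev \<phi> (x0, t0) v" "open \<Omega>" "(x0, t0) \<in> \<Omega>"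
  obtains p q r where "r > 0" "ball x0 r \<times> ball t0 r \<subseteq> \<Omega>"
    "\<And>i. ev (coeff p i) holomorphic_on ball x0 r" "\<And>i. ev (coeff q i) holomorphic_on ball x0 r"
    "\<And>x t. x \<in> ball x0 r \<Longrightarrow> t \<in> ball t0 r \<Longrightarrow> tau_eval ev q x t \<noteq> 0"
    "\<And>x t. x \<in> ball x0 r \<Longrightarrow> t \<in> ball t0 r \<Longrightarrow>
       has_value_at K ev \<phi> (x, t) (tau_eval ev p x t / tau_eval ev q x t)"
proof -
  obtain p q where pq: "\<phi> = Fract p q" "q \<noteq> 0" "\<And>i. coeff p i \<in> K" "\<And>i. coeff q i \<in> K"
    "\<And>i. ev (coeff p i) analytic_on {x0}" "\<And>i. ev (coeff q i) analytic_on {x0}"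
    "tau_eval ev q x0 t0 \<noteq> 0"
    using assms(1) unfolding has_value_at_iff by blast
  have "finite (ev ` (range (coeff p) \<union> range (coeff q)))"
    by (simp add: range_coeff)
  then obtain r0 where r0: "r0 > 0"
    "\<And>f. f \<in> ev ` (range (coeff p) \<union> range (coeff q)) \<Longrightarrow> f holomorphic_on ball x0 r0"
    using finite_analytic_imp_holomorphic_ball[of _ x0] pq(5,6) by (smt (verit) UnE imageE)
  then have hol: "ev (coeff p i) holomorphic_on ball x0 r0" "ev (coeff q i) holomorphic_on ball x0 r0" for i
    by auto
  define N where "N = {z \<in> ball x0 r0 \<times> UNIV. (\<lambda>(x, t). tau_eval ev q x t) z \<noteq> 0} \<inter> \<Omega>"
  have "open ((ball x0 r0 \<times> UNIV) \<inter> (\<lambda>(x, t). tau_eval ev q x t) -` (- {0}))"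
    using hol by (intro continuous_open_preimage continuous_on_tau_eval open_Times) auto
  moreover have "N = ((ball x0 r0 \<times> UNIV) \<inter> (\<lambda>(x, t). tau_eval ev q x t) -` (- {0})) \<inter> \<Omega>"
    by (auto simp: N_def)
  ultimately have "open N" using assms(2) by (simp only: open_Int)
  moreover have "(x0, t0) \<in> N" using assms(3) pq(7) r0(1) by (simp add: N_def)
  ultimately obtain V V' where V: "open V" "open V'" "x0 \<in> V" "t0 \<in> V'" "V \<times> V' \<subseteq> N"
    by (elim open_prod_elim) auto
  obtain r1 r2 where r12: "r1 > 0" "ball x0 r1 \<subseteq> V" "r2 > 0" "ball t0 r2 \<subseteq> V'"
    using V(1-4) openE[of V x0] openE[of V' t0] by metis
  define r where "r = min r0 (min r1 r2)"
  have r: "r > 0" "ball x0 r \<subseteq> ball x0 r0" "ball x0 r \<times> ball t0 r \<subseteq> N"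
  proof -
    have "ball x0 r \<subseteq> ball x0 r1" "ball t0 r \<subseteq> ball t0 r2" by (auto simp: r_def)
    then have "ball x0 r \<times> ball t0 r \<subseteq> V \<times> V'" using r12(2,4) by (intro Sigma_mono) auto
    then show "ball x0 r \<times> ball t0 r \<subseteq> N" using V(5) by simp
  qed (use r0(1) r12(1,3) in \<open>auto simp: r_def\<close>)
  show ?thesis
  proof (rule that[of r p q])
    show "has_value_at K ev \<phi> (x, t) (tau_eval ev p x t / tau_eval ev q x t)"
      if "x \<in> ball x0 r" "t \<in> ball t0 r" for x t
    proof -
      have "ev (coeff p i) analytic_on {x}" "ev (coeff q i) analytic_on {x}" for i
        using hol[of i] that(1) r(2) by (auto intro!: analytic_at[THEN iffD2])
      moreover have "(x, t) \<in> N" using that r(3) by blast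
      then have "tau_eval ev q x t \<noteq> 0" by (simp add: N_def)
      ultimately show ?thesis unfolding has_value_at_iff using pq by blast
    qed
    show "tau_eval ev q x t \<noteq> 0" if "x \<in> ball x0 r" "t \<in> ball t0 r" for x t
    proof -
      have "(x, t) \<in> N" using that r(3) by blast
      then show ?thesis by (simp add: N_def)
    qed
    show "ball x0 r \<times> ball t0 r \<subseteq> \<Omega>" using r(3) by (auto simp: N_def)
    show "ev (coeff p i) holomorphic_on ball x0 r" "ev (coeff q i) holomorphic_on ball x0 r" for i
      using hol r(2) by (blast intro: holomorphic_on_subset)+
  qed (use r in auto)
qed

section \<open>Fields of meromorphic functions\<close>

text \<open>A field whose elements stand for meromorphic functions, with field operations that are
  pointwise off a discrete set. Since only almost all points are controlled, evaluation at a
  fixed point is not a homomorphism; the identities for polynomials in \<open>\<tau>\<close> below therefore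
  exclude a discrete set of \<open>x\<close>, chosen independently of \<open>t\<close>.\<close>

locale meromorphic_field =
  fixes D :: "complex set" and K :: "'k::field set" and ev :: "'k \<Rightarrow> complex \<Rightarrow> complex"
  assumes open_D: "open D"
    and zero_K: "0 \<in> K" and uminus_K: "f \<in> K \<Longrightarrow> - f \<in> K"
    and add_K: "f \<in> K \<Longrightarrow> g \<in> K \<Longrightarrow> f + g \<in> K"
    and mult_K: "f \<in> K \<Longrightarrow> g \<in> K \<Longrightarrow> f * g \<in> K"
    and inverse_K: "f \<in> K \<Longrightarrow> inverse f \<in> K"
    and ev_meromorphic: "f \<in> K \<Longrightarrow> ev f meromorphic_on D"
    and ev_0: "\<forall>\<^sub>\<approx>x\<in>D. ev 0 x = 0" and ev_1: "\<forall>\<^sub>\<approx>x\<in>D. ev 1 x = 1"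
    and ev_add: "f \<in> K \<Longrightarrow> g \<in> K \<Longrightarrow> \<forall>\<^sub>\<approx>x\<in>D. ev (f + g) x = ev f x + ev g x"
    and ev_mult: "f \<in> K \<Longrightarrow> g \<in> K \<Longrightarrow> \<forall>\<^sub>\<approx>x\<in>D. ev (f * g) x = ev f x * ev g x"
begin

lemma sum_K: "(\<And>i. i \<in> S \<Longrightarrow> f i \<in> K) \<Longrightarrow> sum f S \<in> K"
  by (induction S rule: infinite_finite_induct) (auto simp: zero_K add_K)

lemma tau_eval_pCons:
  "\<forall>\<^sub>\<approx>x\<in>D. \<forall>t. tau_eval ev (pCons a p) x t = ev a x + t * tau_eval ev p x t"
  using ev_0
proof eventually_elim
  case (elim x)
  show ?case
  proof (cases "p = 0")
    case True
    then show ?thesis using elim by (simp add: tau_eval_def)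
  next
    case False
    then show ?thesis
      by (simp add: tau_eval_def sum.atMost_Suc_shift sum_distrib_left mult_ac del: sum.atMost_Suc)
  qed
qed

lemma tau_eval_0: "\<forall>\<^sub>\<approx>x\<in>D. \<forall>t. tau_eval ev 0 x t = 0"
  using ev_0 by eventually_elim (simp add: tau_eval_def)

lemma tau_eval_add:
  assumes "\<And>i. coeff p i \<in> K" "\<And>i. coeff q i \<in> K"
  shows "\<forall>\<^sub>\<approx>x\<in>D. \<forall>t. tau_eval ev (p + q) x t = tau_eval ev p x t + tau_eval ev q x t"
  using assms
proof (induction p q rule: poly_induct2)
  case 0
  show ?case using tau_eval_0 by eventually_elim simp
next
  case (pCons a p b q)
  have ab: "a \<in> K" "b \<in> K" using pCons.prems[of 0] by simp_all
  have "\<forall>\<^sub>\<approx>x\<in>D. \<forall>t. tau_eval ev (p + q) x t = tau_eval ev p x t + tau_eval ev q x t"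
    using pCons.prems[of "Suc i" for i] by (intro pCons.IH) simp_all
  then show ?case
    using ev_add[OF ab] tau_eval_pCons[of a p] tau_eval_pCons[of b q] tau_eval_pCons[of "a + b" "p + q"]
    by eventually_elim (simp add: algebra_simps)
qed

lemma tau_eval_smult:
  assumes "a \<in> K" "\<And>i. coeff p i \<in> K"
  shows "\<forall>\<^sub>\<approx>x\<in>D. \<forall>t. tau_eval ev (smult a p) x t = ev a x * tau_eval ev p x t"
  using assms(2)
proof (induction p)
  case 0
  show ?case using tau_eval_0 by eventually_elim simp
next
  case (pCons b p)
  have b: "b \<in> K" using pCons.prems[of 0] by simp
  have "\<forall>\<^sub>\<approx>x\<in>D. \<forall>t. tau_eval ev (smult a p) x t = ev a x * tau_eval ev p x t"
    using pCons.prems[of "Suc i" for i] by (intro pCons.IH) simp_all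
  then show ?case
    using ev_mult[OF assms(1) b] tau_eval_pCons[of b p] tau_eval_pCons[of "a * b" "smult a p"]
    by eventually_elim (simp add: algebra_simps)
qed

lemma tau_eval_mult:
  assumes "\<And>i. coeff p i \<in> K" "\<And>i. coeff q i \<in> K"
  shows "\<forall>\<^sub>\<approx>x\<in>D. \<forall>t. tau_eval ev (p * q) x t = tau_eval ev p x t * tau_eval ev q x t"
  using assms(1)
proof (induction p)
  case 0
  show ?case using tau_eval_0 by eventually_elim simp
next
  case (pCons a p)
  have a: "a \<in> K" and p: "\<And>i. coeff p i \<in> K"
    using pCons.prems[of 0] pCons.prems[of "Suc i" for i] by simp_all
  have aq: "coeff (smult a q) i \<in> K" and pq: "coeff (p * q) i \<in> K" for i
    using a p assms(2) by (auto simp: coeff_mult intro!: mult_K sum_K)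
  then have pq': "coeff (pCons 0 (p * q)) i \<in> K" for i
    by (auto simp: coeff_pCons zero_K split: nat.split)
  show ?case
    using pCons.IH[OF p] tau_eval_add[of "smult a q" "pCons 0 (p * q)", OF aq pq']
      tau_eval_smult[OF a assms(2)] tau_eval_pCons[of a p] tau_eval_pCons[of 0 "p * q"] ev_0
    by eventually_elim (simp add: algebra_simps)
qed

lemma isCont_tau_eval:
  assumes "\<And>i. ev (coeff p i) analytic_on {x}"
  shows "isCont (\<lambda>y. tau_eval ev p y t) x"
  unfolding tau_eval_def using assms by (intro continuous_intros analytic_at_imp_isCont) auto

text \<open>At \<open>x\<close> itself the evaluation of products is not known to be multiplicative, because \<open>x\<close> may be
  one of the exceptional points. Equality there is the limit of the equality nearby.\<close>

lemma has_value_at_unique: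
  assumes "x \<in> D" "has_value_at K ev \<phi> (x, t) v" "has_value_at K ev \<phi> (x, t) w"
  shows "v = w"
proof -
  obtain p q where pq: "\<phi> = Fract p q" "q \<noteq> 0" "\<And>i. coeff p i \<in> K" "\<And>i. coeff q i \<in> K"
    "\<And>i. ev (coeff p i) analytic_on {x}" "\<And>i. ev (coeff q i) analytic_on {x}"
    "tau_eval ev q x t \<noteq> 0" "v = tau_eval ev p x t / tau_eval ev q x t"
    using assms(2) unfolding has_value_at_iff by blast
  obtain p' q' where pq': "\<phi> = Fract p' q'" "q' \<noteq> 0" "\<And>i. coeff p' i \<in> K" "\<And>i. coeff q' i \<in> K"
    "\<And>i. ev (coeff p' i) analytic_on {x}" "\<And>i. ev (coeff q' i) analytic_on {x}"
    "tau_eval ev q' x t \<noteq> 0" "w = tau_eval ev p' x t / tau_eval ev q' x t"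
    using assms(3) unfolding has_value_at_iff by blast
  define l where "l y = tau_eval ev p y t * tau_eval ev q' y t" for y
  define r where "r y = tau_eval ev p' y t * tau_eval ev q y t" for y
  have eq: "p * q' = p' * q" using pq(1,2) pq'(1,2) by (simp add: eq_fract)
  have "\<forall>\<^sub>\<approx>y\<in>D. l y = r y"
    using tau_eval_mult[OF pq(3) pq'(4)] tau_eval_mult[OF pq'(3) pq(4)]
    by eventually_elim (metis eq l_def r_def)
  then have near: "\<forall>\<^sub>F y in at x. l y = r y"
    using assms(1) by (rule eventually_cosparse_imp_eventually_at)
  have "isCont l x" "isCont r x"
    unfolding l_def r_def by (intro continuous_intros isCont_tau_eval pq pq')+
  then have "(l \<longlongrightarrow> l x) (at x)" "(l \<longlongrightarrow> r x) (at x)"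
    unfolding isCont_def using tendsto_cong[OF near] by auto
  then have "l x = r x" by (intro tendsto_unique[of "at x"]) auto
  then show ?thesis using pq(7,8) pq'(7,8) by (simp add: l_def r_def frac_eq_eq)
qed

lemma value_at_eqI:
  "x \<in> D \<Longrightarrow> has_value_at K ev \<phi> (x, t) v \<Longrightarrow> value_at K ev \<phi> (x, t) = v"
  unfolding value_at_def using has_value_at_unique by blast

end

lemma diff_field_gen_meromorphic_field:
  assumes "open D" "diff_field_const_C \<delta> \<iota>"
    and "field_of_functions D (diff_field_gen \<delta> \<iota> u) \<delta> \<iota> ev"
  shows "meromorphic_field D (diff_field_gen \<delta> \<iota> u) ev"
proof -
  let ?K = "diff_field_gen \<delta> \<iota> u"
  have \<iota>: "\<iota> 1 = 1" "\<And>a b. \<iota> (a + b) = \<iota> a + \<iota> b" using assms(2) by (auto simp: diff_field_const_C_def)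
  have \<iota>0: "\<iota> 0 = 0" using \<iota>(2)[of 0 0] by (metis add.right_neutral add_cancel_right_right)
  then have \<iota>m: "\<iota> (-1) = -1" using \<iota>(2)[of "-1" 1] \<iota>(1) by (simp add: eq_neg_iff_add_eq_0)
  have const: "\<And>c. \<forall>\<^sub>\<approx>x\<in>D. ev (\<iota> c) x = c" using assms(3) by (auto simp: field_of_functions_def)
  show ?thesis
  proof
    show "0 \<in> ?K" using diff_field_gen.const[of \<iota> 0] \<iota>0 by simp
    show "- f \<in> ?K" if "f \<in> ?K" for f
      using diff_field_gen.mult[OF diff_field_gen.const[of \<iota> "-1"] that] \<iota>m by simp
    show "\<forall>\<^sub>\<approx>x\<in>D. ev 0 x = 0" "\<forall>\<^sub>\<approx>x\<in>D. ev 1 x = 1" using const[of 0] const[of 1] \<iota>0 \<iota>(1) by auto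
  qed (use assms in \<open>auto simp: field_of_functions_def nicely_meromorphic_on_def intro: diff_field_gen.intros\<close>)
qed

lemma (in meromorphic_field) right_factor_in_ratfuns_over:
  assumes "spectral_right_factor d \<iota> K L A \<chi>1 \<chi>2 \<phi>"
  shows "\<phi> \<in> ratfuns_over K"
proof -
  have "coeff [:- \<phi>, 1:] 0 \<in> ratfuns_over K"
    using assms unfolding spectral_right_factor_def is_monic_gcrd_def dops_over_def by blast
  then obtain p q where pq: "- \<phi> = Fract p q" "q \<noteq> 0" "\<And>i. coeff p i \<in> K" "\<And>i. coeff q i \<in> K"
    by (auto simp: ratfuns_over_def)
  then have "\<phi> = Fract (- p) q" by (metis minus_fract minus_minus)
  then show ?thesis using pq uminus_K unfolding ratfuns_over_def by (force simp: coeff_minus)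
qed

section \<open>Regular points exist\<close>

lemma is_domain_box: "r > 0 \<Longrightarrow> is_domain (ball x r \<times> ball t r)"
  by (auto simp: is_domain_def open_Times connected_Times)

lemma zariski_open_imp_open: "zariski_open U \<Longrightarrow> open U"
proof -
  assume "zariski_open U"
  then obtain S where "U = (\<Union>p\<in>S. {t. poly p t \<noteq> 0})" by (auto simp: zariski_open_def)
  then show ?thesis by (auto intro!: open_UN open_Collect_neq continuous_intros)
qed

lemma zariski_open_inter_nonroot:
  assumes "zariski_open U" "U \<noteq> {}" "f \<noteq> 0"
  obtains t where "t \<in> U" "poly f t \<noteq> 0"
proof -
  obtain S where S: "U = {t. \<exists>p\<in>S. poly p t \<noteq> 0}" using assms(1) by (auto simp: zariski_open_def)
  then obtain p where p: "p \<in> S" "p \<noteq> 0" using assms(2) by fastforce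
  then have "p * f \<noteq> 0" using assms(3) by simp
  then have "{t. poly (p * f) t = 0} \<noteq> UNIV" using poly_roots_finite infinite_UNIV_char_0 by metis
  then show ?thesis using that S p(1) by auto
qed

context meromorphic_field
begin

text \<open>The identity \<open>f * inverse f = 1\<close>, evaluated, keeps \<open>ev f\<close> from vanishing identically on any
  component of \<open>D\<close>.\<close>

lemma ev_nonzero:
  assumes "f \<in> K" "f \<noteq> 0"
  shows "\<forall>\<^sub>\<approx>x\<in>D. ev f x \<noteq> 0"
  using ev_mult[OF assms(1) inverse_K[OF assms(1)]] ev_1
  by eventually_elim (use assms(2) in auto)

lemma exists_has_value_at:
  assumes "\<phi> \<in> ratfuns_over K" "D \<noteq> {}" "zariski_open U" "U \<noteq> {}"
  obtains x t v where "x \<in> D" "t \<in> U" "has_value_at K ev \<phi> (x, t) v"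
proof -
  obtain p q where pq: "\<phi> = Fract p q" "q \<noteq> 0" "\<And>i. coeff p i \<in> K" "\<And>i. coeff q i \<in> K"
    using assms(1) by (auto simp: ratfuns_over_def)
  have "\<forall>\<^sub>\<approx>x\<in>D. \<forall>f\<in>range (coeff p) \<union> range (coeff q). ev f analytic_on {x}"
    using pq(3,4) by (intro eventually_ball_finite)
      (auto simp: range_coeff zero_K intro!: meromorphic_on_imp_analytic_cosparse ev_meromorphic)
  moreover have "\<forall>\<^sub>\<approx>x\<in>D. ev (lead_coeff q) x \<noteq> 0"
    using pq by (intro ev_nonzero) auto
  moreover have "\<forall>\<^sub>\<approx>x\<in>D. x \<in> D"
    using open_D by (intro eventually_in_cosparse) auto
  ultimately have ev: "\<forall>\<^sub>\<approx>x\<in>D. (\<forall>f\<in>range (coeff p) \<union> range (coeff q). ev f analytic_on {x}) \<and>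
      ev (lead_coeff q) x \<noteq> 0 \<and> x \<in> D"
    by (intro eventually_conj)
  moreover have "cosparse D \<noteq> bot" using assms(2) by simp
  ultimately obtain x where x: "\<forall>f\<in>range (coeff p) \<union> range (coeff q). ev f analytic_on {x}"
      "ev (lead_coeff q) x \<noteq> 0" "x \<in> D"
    using eventually_happens'[of "cosparse D"] by blast
  \<comment> \<open>The denominator at this \<open>x\<close>, as a polynomial in \<open>\<tau>\<close> over the complex numbers.\<close>
  define f where "f = (\<Sum>i\<le>degree q. monom (ev (coeff q i) x) i)"
  have "coeff f (degree q) = ev (lead_coeff q) x"
    by (simp add: f_def coeff_sum)
  then have "f \<noteq> 0" using x(2) by auto
  then obtain t where t: "t \<in> U" "poly f t \<noteq> 0"
    using zariski_open_inter_nonroot assms(3,4) by blast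
  have "tau_eval ev q x t \<noteq> 0"
    using t(2) by (simp add: f_def poly_sum poly_monom tau_eval_def)
  then have "has_value_at K ev \<phi> (x, t) (tau_eval ev p x t / tau_eval ev q x t)"
    unfolding has_value_at_iff using pq x(1) by blast
  then show ?thesis using that x(3) t(1) by blast
qed

lemma exists_regular_domain:
  assumes "\<phi> \<in> ratfuns_over K" "D \<noteq> {}" "zariski_open U" "U \<noteq> {}"
  shows "\<exists>\<Omega>. is_domain \<Omega> \<and> \<Omega> \<subseteq> D \<times> U \<and> (\<forall>z\<in>\<Omega>. regular_at K ev \<phi> z)"
proof -
  obtain x t v where xt: "x \<in> D" "t \<in> U" "has_value_at K ev \<phi> (x, t) v"
    using exists_has_value_at[OF assms] .
  have "open (D \<times> U)" using open_D zariski_open_imp_open[OF assms(3)] by (rule open_Times)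
  from has_value_at_box[OF xt(3) this] xt(1,2) obtain p q r where
    "r > 0" "ball x r \<times> ball t r \<subseteq> D \<times> U"
    "\<And>y s. y \<in> ball x r \<Longrightarrow> s \<in> ball t r \<Longrightarrow>
       has_value_at K ev \<phi> (y, s) (tau_eval ev p y s / tau_eval ev q y s)"
    by (metis mem_Sigma_iff)
  then show ?thesis
    by (intro exI[of _ "ball x r \<times> ball t r"]) (fastforce simp: regular_at_def is_domain_box)
qed

end

section \<open>Solutions near a regular point\<close>

lemma (in meromorphic_field) exists_local_solution:
  assumes "open \<Omega>" "\<Omega> \<subseteq> D \<times> U" "c \<in> \<Omega>" "regular_at K ev \<phi> c"
  shows "\<exists>W \<Upsilon>. is_domain W \<and> W \<subseteq> \<Omega> \<and> c \<in> W \<and> analytic2_on \<Upsilon> W \<and> (\<forall>z\<in>W. \<Upsilon> z \<noteq> 0) \<and>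
    (\<forall>(x, t)\<in>W. ((\<lambda>\<xi>. \<Upsilon> (\<xi>, t)) has_field_derivative value_at K ev \<phi> (x, t) * \<Upsilon> (x, t)) (at x))"
proof -
  obtain x0 t0 where c: "c = (x0, t0)" by force
  then obtain v where v: "has_value_at K ev \<phi> (x0, t0) v" using assms(4) by (auto simp: regular_at_def)
  obtain p q r where r: "r > 0" "ball x0 r \<times> ball t0 r \<subseteq> \<Omega>"
    and hol: "\<And>i. ev (coeff p i) holomorphic_on ball x0 r" "\<And>i. ev (coeff q i) holomorphic_on ball x0 r"
    and nz: "\<And>x t. x \<in> ball x0 r \<Longrightarrow> t \<in> ball t0 r \<Longrightarrow> tau_eval ev q x t \<noteq> 0"
    and val: "\<And>x t. x \<in> ball x0 r \<Longrightarrow> t \<in> ball t0 r \<Longrightarrow>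
       has_value_at K ev \<phi> (x, t) (tau_eval ev p x t / tau_eval ev q x t)"
    using has_value_at_box[OF v assms(1)] assms(3) c by metis
  let ?X = "ball x0 r" and ?T = "ball t0 r"
  let ?W = "?X \<times> ?T"
  define g where "g x t = tau_eval ev p x t / tau_eval ev q x t" for x t
  obtain p' where p': "\<And>x t. (tau_eval ev p x has_field_derivative p' x t) (at t)"
    "continuous_on ?W (\<lambda>(x, t). p' x t)"
    using tau_eval_derivative_tau[where ev = ev and p = p and X = ?X and T = ?T, OF hol(1)] by blast
  obtain q' where q': "\<And>x t. (tau_eval ev q x has_field_derivative q' x t) (at t)"
    "continuous_on ?W (\<lambda>(x, t). q' x t)"
    using tau_eval_derivative_tau[where ev = ev and p = q and X = ?X and T = ?T, OF hol(2)] by blast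
  define gt where "gt x t = (p' x t * tau_eval ev q x t - tau_eval ev p x t * q' x t) /
    (tau_eval ev q x t * tau_eval ev q x t)" for x t
  note cont = continuous_on_tau_eval[where ev = ev and p = p and X = ?X and T = ?T, OF hol(1)]
    continuous_on_tau_eval[where ev = ev and p = q and X = ?X and T = ?T, OF hol(2)]
    p'(2) q'(2)
  obtain F where F: "\<And>x t. x \<in> ?X \<Longrightarrow> t \<in> ?T \<Longrightarrow> ((\<lambda>x. F (x, t)) has_field_derivative g x t) (at x)"
    "holomorphic2_on F ?W"
  proof (rule holomorphic2_parameter_primitive[where w = x0])
    show "(\<lambda>x. g x t) holomorphic_on ?X" if "t \<in> ?T" for t
      unfolding g_def using nz that by (intro holomorphic_intros holomorphic_on_tau_eval hol) auto
    show "(g x has_field_derivative gt x t) (at t)" if "x \<in> ?X" "t \<in> ?T" for x t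
      unfolding g_def[abs_def] gt_def by (intro DERIV_divide p' q' nz that)
    show "continuous_on ?W (\<lambda>(x, t). g x t)" "continuous_on ?W (\<lambda>(x, t). gt x t)"
      unfolding g_def gt_def using cont nz unfolding split_beta
      by (auto intro!: continuous_intros)
  qed (use r in auto)
  have "((\<lambda>\<xi>. exp (F (\<xi>, t))) has_field_derivative value_at K ev \<phi> (x, t) * exp (F (x, t))) (at x)"
    if "(x, t) \<in> ?W" for x t
  proof -
    have "x \<in> D" using that r(2) assms(2) by blast
    then have "value_at K ev \<phi> (x, t) = g x t" using val[of x t] that value_at_eqI by (auto simp: g_def)
    moreover have "((\<lambda>\<xi>. exp (F (\<xi>, t))) has_field_derivative exp (F (x, t)) * g x t) (at x)"
      using that by (intro DERIV_fun_exp F) auto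
    ultimately show ?thesis by (simp add: mult.commute)
  qed
  moreover have "analytic2_on (\<lambda>z. exp (F z)) ?W"
    using F(2) by (intro analytic2_on_exp) (auto intro: open_Times)
  moreover have "c \<in> ?W" using r(1) c by simp
  ultimately show ?thesis
    using r(2) is_domain_box[OF r(1), of x0 t0]
    by (intro exI[of _ ?W] exI[of _ "\<lambda>z. exp (F z)"]) auto
qed

theorem theorem6p6:
  fixes \<delta> :: "'k::field \<Rightarrow> 'k" and \<iota> :: "complex \<Rightarrow> 'k" and u :: 'k
    and D U :: "complex set" and us :: "complex \<Rightarrow> complex" and ev :: "'k \<Rightarrow> complex \<Rightarrow> complex"
    and s :: nat and A :: "'k poly" and R :: "complex poly"
    and \<chi>1 \<chi>2 :: "complex poly fract"
    and d :: "'k poly fract \<Rightarrow> 'k poly fract" and \<phi> :: "'k poly fract"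
  defines "K \<equiv> diff_field_gen \<delta> \<iota> u"
    and "L \<equiv> schroedinger u"
  assumes "open D" and "D \<noteq> {}" and "us analytic_on D"
    and "diff_field_const_C \<delta> \<iota>" and "u \<notin> range \<iota>"
    and "field_of_functions D K \<delta> \<iota> ev" and "\<forall>x\<in>D. ev u x = us x"
    and "algebro_geometric \<delta> L"
    and "centralizer_generator \<delta> \<iota> L s A R"
    and "rational_spectral_curve R"
    and "rational_parametrization R U \<chi>1 \<chi>2"
    and "extends_to_tau \<delta> d"
    and "spectral_right_factor d \<iota> K L A \<chi>1 \<chi>2 \<phi>"
  shows "(\<exists>\<Omega>. is_domain \<Omega> \<and> \<Omega> \<subseteq> D \<times> U \<and> (\<forall>z\<in>\<Omega>. regular_at K ev \<phi> z)) \<and>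
    (\<forall>\<Omega>. is_domain \<Omega> \<and> \<Omega> \<subseteq> D \<times> U \<and> (\<forall>z\<in>\<Omega>. regular_at K ev \<phi> z) \<longrightarrow>
      (\<forall>c\<in>\<Omega>. \<exists>W \<Upsilon>. is_domain W \<and> W \<subseteq> \<Omega> \<and> c \<in> W \<and> analytic2_on \<Upsilon> W \<and>
         (\<forall>z\<in>W. \<Upsilon> z \<noteq> 0) \<and>
         (\<forall>(x, t)\<in>W.
            ((\<lambda>\<xi>. \<Upsilon> (\<xi>, t)) has_field_derivative value_at K ev \<phi> (x, t) * \<Upsilon> (x, t)) (at x))))"
proof -
  interpret meromorphic_field D K ev
    using assms unfolding K_def by (intro diff_field_gen_meromorphic_field)
  have U: "zariski_open U" "U \<noteq> {}"
    using assms(13) by (simp_all add: rational_parametrization_def)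
  have "\<phi> \<in> ratfuns_over K" using assms(15) by (rule right_factor_in_ratfuns_over)
  from exists_regular_domain[OF this assms(4) U] show ?thesis
    using exists_local_solution[of _ U _ \<phi>] by (simp add: is_domain_def)
qed

end
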